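(* (1) For any $a, b \in \mathfrak{C}_0^{*}$ such that $N(a) = N(b)$, there exists $p \in \mathfrak{C}_0^{*}$ such that $pap^{-1} = b$. (2) Let $K = \mathfrak{C}'$ or $K = \mathfrak{C}^C$. For any $a, b \in K_0^{*}$ such that $N(a) = N(b)$, there exist $p, q \in K_0^{\times}$ such that $q(pap^{-1})q^{-1} = b$.
   Context: Let $\mathbf{H}$ be the real quaternion algebra with $\mathbb{R}$-basis $1, e_1, e_2, e_3$ and $e_1^2=e_2^2=e_3^2=-1$, $e_1e_2=e_3=-e_2e_1$, $e_2e_3=e_1=-e_3e_2$, $e_3e_1=e_2=-e_1e_3$. Let $\mathbf{H}'$ be the split quaternion algebra: the real associative algebra with $\mathbb{R}$-basis $1, e_1', e_2, e_3'$ and $e_1'^2=e_3'^2=1$, $e_2^2=-1$, $e_1'e_2=e_3'=-e_2e_1'$, $e_2e_3'=e_1'=-e_3'e_2$, $e_3'e_1'=-e_2=-e_1'e_3'$. In both, the conjugation $m\mapsto\overline{m}$ is the $\mathbb{R}$-linear map fixing $1$ and negating the other three basis elements. Let $\mathfrak{C}=\mathbf{H}\oplus\mathbf{H}e_4$ (division Cayley algebra) and $\mathfrak{C}'=\mathbf{H}'\oplus\mathbf{H}'e_4$ (split Cayley algebra), the real algebras with multiplication $(m_1+n_1e_4)(m_2+n_2e_4)=(m_1m_2-\overline{n_2}n_1)+(n_1\overline{m_2}+n_2m_1)e_4$ and conjugation $\overline{m+ne_4}=\overline{m}-ne_4$. Let $\mathfrak{C}^C=\mathfrak{C}\oplus i\mathfrak{C}$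 be the complexification of $\mathfrak{C}$ (complex Cayley algebra), with multiplication and conjugation extended complex-linearly. For $K$ any of $\mathfrak{C},\mathfrak{C}',\mathfrak{C}^C$: the inner product is $(a,b)=\frac12(a\overline{b}+b\overline{a})$ and the norm is $N(a)=(a,a)=a\overline{a}$ (real-valued for $\mathfrak{C},\mathfrak{C}'$, complex-valued for $\mathfrak{C}^C$). If $N(a)\neq0$ then $a$ is invertible with $a^{-1}=\overline{a}/N(a)$. Put $K_0=\{a\in K\mid\overline{a}=-a\}$, $K_0^{*}=\{a\in K_0\mid a\neq0\}$, $K_0^{\times}=\{a\in K_0\mid N(a)\neq0\}$. The expression $pap^{-1}$ means $(pa)p^{-1}=p(ap^{-1})$ (these agree since the algebras are alternative). *)

theory Defs
  imports Complex_Main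
begin

class conjugation = uminus +
  fixes cjg :: "'a \<Rightarrow> 'a"

text \<open>\<open>scalar_part\<close> is the coefficient of the basis element \<open>1\<close>.\<close>

class conj_algebra = real_vector + one + times + conjugation +
  fixes scalar_part :: "'a \<Rightarrow> real"


section \<open>Quaternions and split quaternions\<close>

text \<open>\<open>Quat a0 a1 a2 a3\<close> stands for \<open>a0 + a1 e\<^sub>1 + a2 e\<^sub>2 + a3 e\<^sub>3\<close>.\<close>

codatatype quat = Quat (Q0: real) (Q1: real) (Q2: real) (Q3: real)

lemma quat_eqI:
  "\<lbrakk>Q0 x = Q0 y; Q1 x = Q1 y; Q2 x = Q2 y; Q3 x = Q3 y\<rbrakk> \<Longrightarrow> x = y"
  by (rule quat.expand) simp

lemma quat_eq_iff:
  "x = y \<longleftrightarrow> Q0 x = Q0 y \<and> Q1 x = Q1 y \<and> Q2 x = Q2 y \<and> Q3 x = Q3 y"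
  by (auto intro: quat_eqI)

instantiation quat :: real_algebra_1
begin

primcorec zero_quat where "Q0 0 = 0" | "Q1 0 = 0" | "Q2 0 = 0" | "Q3 0 = 0"

primcorec one_quat where "Q0 1 = 1" | "Q1 1 = 0" | "Q2 1 = 0" | "Q3 1 = 0"

primcorec plus_quat where
  "Q0 (x + y) = Q0 x + Q0 y"
| "Q1 (x + y) = Q1 x + Q1 y"
| "Q2 (x + y) = Q2 x + Q2 y"
| "Q3 (x + y) = Q3 x + Q3 y"

primcorec uminus_quat where
  "Q0 (- x) = - Q0 x" | "Q1 (- x) = - Q1 x" | "Q2 (- x) = - Q2 x" | "Q3 (- x) = - Q3 x"

primcorec minus_quat where
  "Q0 (x - y) = Q0 x - Q0 y"
| "Q1 (x - y) = Q1 x - Q1 y"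
| "Q2 (x - y) = Q2 x - Q2 y"
| "Q3 (x - y) = Q3 x - Q3 y"

primcorec scaleR_quat where
  "Q0 (r *\<^sub>R x) = r * Q0 x"
| "Q1 (r *\<^sub>R x) = r * Q1 x"
| "Q2 (r *\<^sub>R x) = r * Q2 x"
| "Q3 (r *\<^sub>R x) = r * Q3 x"

primcorec times_quat where
  "Q0 (x * y) = Q0 x * Q0 y - Q1 x * Q1 y - Q2 x * Q2 y - Q3 x * Q3 y"
| "Q1 (x * y) = Q0 x * Q1 y + Q1 x * Q0 y + Q2 x * Q3 y - Q3 x * Q2 y"
| "Q2 (x * y) = Q0 x * Q2 y + Q2 x * Q0 y + Q3 x * Q1 y - Q1 x * Q3 y"
| "Q3 (x * y) = Q0 x * Q3 y + Q3 x * Q0 y + Q1 x * Q2 y - Q2 x * Q1 y"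

instance
  by standard (auto simp: quat_eq_iff algebra_simps)

end

instantiation quat :: conj_algebra
begin

primcorec cjg_quat where
  "Q0 (cjg x) = Q0 x" | "Q1 (cjg x) = - Q1 x" | "Q2 (cjg x) = - Q2 x" | "Q3 (cjg x) = - Q3 x"

definition scalar_part_quat :: "quat \<Rightarrow> real" where "scalar_part x = Q0 x"

instance ..

end

lemma quat_basis_products:
  defines "e1 \<equiv> Quat 0 1 0 0" and "e2 \<equiv> Quat 0 0 1 0" and "e3 \<equiv> Quat 0 0 0 1"
  shows "e1 * e1 = - 1" "e2 * e2 = - 1" "e3 * e3 = - 1"
    "e1 * e2 = e3" "e2 * e1 = - e3" "e2 * e3 = e1" "e3 * e2 = - e1"
    "e3 * e1 = e2" "e1 * e3 = - e2"
  by (simp_all add: quat_eq_iff e1_def e2_def e3_def)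

text \<open>\<open>Squat a0 a1 a2 a3\<close> stands for \<open>a0 + a1 e\<^sub>1' + a2 e\<^sub>2 + a3 e\<^sub>3'\<close>.\<close>

codatatype squat = Squat (S0: real) (S1: real) (S2: real) (S3: real)

lemma squat_eqI:
  "\<lbrakk>S0 x = S0 y; S1 x = S1 y; S2 x = S2 y; S3 x = S3 y\<rbrakk> \<Longrightarrow> x = y"
  by (rule squat.expand) simp

lemma squat_eq_iff:
  "x = y \<longleftrightarrow> S0 x = S0 y \<and> S1 x = S1 y \<and> S2 x = S2 y \<and> S3 x = S3 y"
  by (auto intro: squat_eqI)

instantiation squat :: real_algebra_1
begin

primcorec zero_squat where "S0 0 = 0" | "S1 0 = 0" | "S2 0 = 0" | "S3 0 = 0"

primcorec one_squat where "S0 1 = 1" | "S1 1 = 0" | "S2 1 = 0" | "S3 1 = 0"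

primcorec plus_squat where
  "S0 (x + y) = S0 x + S0 y"
| "S1 (x + y) = S1 x + S1 y"
| "S2 (x + y) = S2 x + S2 y"
| "S3 (x + y) = S3 x + S3 y"

primcorec uminus_squat where
  "S0 (- x) = - S0 x" | "S1 (- x) = - S1 x" | "S2 (- x) = - S2 x" | "S3 (- x) = - S3 x"

primcorec minus_squat where
  "S0 (x - y) = S0 x - S0 y"
| "S1 (x - y) = S1 x - S1 y"
| "S2 (x - y) = S2 x - S2 y"
| "S3 (x - y) = S3 x - S3 y"

primcorec scaleR_squat where
  "S0 (r *\<^sub>R x) = r * S0 x"
| "S1 (r *\<^sub>R x) = r * S1 x"
| "S2 (r *\<^sub>R x) = r * S2 x"
| "S3 (r *\<^sub>R x) = r * S3 x"

primcorec times_squat where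
  "S0 (x * y) = S0 x * S0 y + S1 x * S1 y - S2 x * S2 y + S3 x * S3 y"
| "S1 (x * y) = S0 x * S1 y + S1 x * S0 y + S2 x * S3 y - S3 x * S2 y"
| "S2 (x * y) = S0 x * S2 y + S2 x * S0 y - S3 x * S1 y + S1 x * S3 y"
| "S3 (x * y) = S0 x * S3 y + S3 x * S0 y + S1 x * S2 y - S2 x * S1 y"

instance
  by standard (auto simp: squat_eq_iff algebra_simps)

end

instantiation squat :: conj_algebra
begin

primcorec cjg_squat where
  "S0 (cjg x) = S0 x" | "S1 (cjg x) = - S1 x" | "S2 (cjg x) = - S2 x" | "S3 (cjg x) = - S3 x"

definition scalar_part_squat :: "squat \<Rightarrow> real" where "scalar_part x = S0 x"

instance ..

end

lemma squat_basis_products: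
  defines "e1 \<equiv> Squat 0 1 0 0" and "e2 \<equiv> Squat 0 0 1 0" and "e3 \<equiv> Squat 0 0 0 1"
  shows "e1 * e1 = 1" "e2 * e2 = - 1" "e3 * e3 = 1"
    "e1 * e2 = e3" "e2 * e1 = - e3" "e2 * e3 = e1" "e3 * e2 = - e1"
    "e3 * e1 = - e2" "e1 * e3 = e2"
  by (simp_all add: squat_eq_iff e1_def e2_def e3_def)


section \<open>Cayley algebras\<close>

text \<open>\<open>Double m n\<close> stands for \<open>m + n e\<^sub>4\<close>.\<close>

codatatype 'a double = Double (Dfst: 'a) (Dsnd: 'a)

lemma double_eqI: "\<lbrakk>Dfst x = Dfst y; Dsnd x = Dsnd y\<rbrakk> \<Longrightarrow> x = y"
  by (rule double.expand) simp

lemma double_eq_iff: "x = y \<longleftrightarrow> Dfst x = Dfst y \<and> Dsnd x = Dsnd y"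
  by (auto intro: double_eqI)

instantiation double :: (conj_algebra) conj_algebra
begin

primcorec zero_double where "Dfst 0 = 0" | "Dsnd 0 = 0"

primcorec one_double where "Dfst 1 = 1" | "Dsnd 1 = 0"

primcorec plus_double where "Dfst (x + y) = Dfst x + Dfst y" | "Dsnd (x + y) = Dsnd x + Dsnd y"

primcorec uminus_double where "Dfst (- x) = - Dfst x" | "Dsnd (- x) = - Dsnd x"

primcorec minus_double where "Dfst (x - y) = Dfst x - Dfst y" | "Dsnd (x - y) = Dsnd x - Dsnd y"

primcorec scaleR_double where "Dfst (r *\<^sub>R x) = r *\<^sub>R Dfst x" | "Dsnd (r *\<^sub>R x) = r *\<^sub>R Dsnd x"

primcorec times_double where
  "Dfst (x * y) = Dfst x * Dfst y - cjg (Dsnd y) * Dsnd x"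
| "Dsnd (x * y) = Dsnd x * cjg (Dfst y) + Dsnd y * Dfst x"

primcorec cjg_double where "Dfst (cjg x) = cjg (Dfst x)" | "Dsnd (cjg x) = - Dsnd x"

definition scalar_part_double :: "'a double \<Rightarrow> real" where
  "scalar_part x = scalar_part (Dfst x)"

instance
  by standard (auto simp: double_eq_iff scaleR_add_left scaleR_add_right)

end

type_synonym cayley = "quat double"
type_synonym split_cayley = "squat double"

text \<open>
  The element \<open>(a * cjg b + b * cjg a) / 2\<close> is a real multiple of \<open>1\<close>
  (see \<open>cayley_inner_scaleR_one\<close> and \<open>split_cayley_inner_scaleR_one\<close>), and
  \<open>cay_inner a b\<close> is that real number.
\<close>

definition cay_inner :: "'a::conj_algebra double \<Rightarrow> 'a double \<Rightarrow> real" where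
  "cay_inner a b = scalar_part ((1/2) *\<^sub>R (a * cjg b + b * cjg a))"

definition cay_norm :: "'a::conj_algebra double \<Rightarrow> real" where
  "cay_norm a = cay_inner a a"

definition cay_inv :: "'a::conj_algebra double \<Rightarrow> 'a double" where
  "cay_inv a = (1 / cay_norm a) *\<^sub>R cjg a"


section \<open>Complexification\<close>

text \<open>\<open>Cplx x y\<close> stands for \<open>x + i y\<close>.\<close>

codatatype 'a complexified = Cplx (CRe: 'a) (CIm: 'a)

lemma complexified_eqI: "\<lbrakk>CRe x = CRe y; CIm x = CIm y\<rbrakk> \<Longrightarrow> x = y"
  by (rule complexified.expand) simp

lemma complexified_eq_iff: "x = y \<longleftrightarrow> CRe x = CRe y \<and> CIm x = CIm y"
  by (auto intro: complexified_eqI)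

instantiation complexified :: (conj_algebra) "{real_vector, one, times, conjugation}"
begin

primcorec zero_complexified where "CRe 0 = 0" | "CIm 0 = 0"

primcorec one_complexified where "CRe 1 = 1" | "CIm 1 = 0"

primcorec plus_complexified where "CRe (x + y) = CRe x + CRe y" | "CIm (x + y) = CIm x + CIm y"

primcorec uminus_complexified where "CRe (- x) = - CRe x" | "CIm (- x) = - CIm x"

primcorec minus_complexified where "CRe (x - y) = CRe x - CRe y" | "CIm (x - y) = CIm x - CIm y"

primcorec scaleR_complexified where
  "CRe (r *\<^sub>R x) = r *\<^sub>R CRe x" | "CIm (r *\<^sub>R x) = r *\<^sub>R CIm x"

primcorec times_complexified where
  "CRe (x * y) = CRe x * CRe y - CIm x * CIm y"
| "CIm (x * y) = CRe x * CIm y + CIm x * CRe y"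

primcorec cjg_complexified where "CRe (cjg x) = cjg (CRe x)" | "CIm (cjg x) = cjg (CIm x)"

instance
  by standard (auto simp: complexified_eq_iff scaleR_add_left scaleR_add_right)

end

type_synonym complex_cayley = "cayley complexified"

primcorec scaleC :: "complex \<Rightarrow> 'a::real_vector complexified \<Rightarrow> 'a complexified"
  (infixr "*\<^sub>c" 75) where
  "CRe (c *\<^sub>c x) = Re c *\<^sub>R CRe x - Im c *\<^sub>R CIm x"
| "CIm (c *\<^sub>c x) = Re c *\<^sub>R CIm x + Im c *\<^sub>R CRe x"

definition cscalar_part :: "'a::conj_algebra complexified \<Rightarrow> complex" where
  "cscalar_part x = Complex (scalar_part (CRe x)) (scalar_part (CIm x))"

definition ccay_inner :: "'a::conj_algebra complexified \<Rightarrow> 'a complexified \<Rightarrow> complex" where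
  "ccay_inner a b = cscalar_part ((1/2) *\<^sub>c (a * cjg b + b * cjg a))"

definition ccay_norm :: "'a::conj_algebra complexified \<Rightarrow> complex" where
  "ccay_norm a = ccay_inner a a"

definition ccay_inv :: "'a::conj_algebra complexified \<Rightarrow> 'a complexified" where
  "ccay_inv a = (1 / ccay_norm a) *\<^sub>c cjg a"


section \<open>Pure elements\<close>

definition pure :: "'a::conjugation set" where
  "pure = {a. cjg a = - a}"

definition pure_nonzero :: "'a::{conjugation, zero} set" where
  "pure_nonzero = {a \<in> pure. a \<noteq> 0}"

definition pure_units :: "'a::conj_algebra double set" where
  "pure_units = {a \<in> pure. cay_norm a \<noteq> 0}"

definition cpure_units :: "'a::conj_algebra complexified set" where
  "cpure_units = {a \<in> pure. ccay_norm a \<noteq> 0}"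


section \<open>Consistency of the conventions\<close>

lemmas cayley_coords = double_eq_iff quat_eq_iff scalar_part_double_def scalar_part_quat_def
lemmas split_cayley_coords = double_eq_iff squat_eq_iff scalar_part_double_def scalar_part_squat_def

lemma cayley_inner_scaleR_one:
  fixes a b :: cayley
  shows "cay_inner a b *\<^sub>R 1 = (1/2) *\<^sub>R (a * cjg b + b * cjg a)"
  by (simp add: cay_inner_def cayley_coords algebra_simps)

lemma split_cayley_inner_scaleR_one:
  fixes a b :: split_cayley
  shows "cay_inner a b *\<^sub>R 1 = (1/2) *\<^sub>R (a * cjg b + b * cjg a)"
  by (simp add: cay_inner_def split_cayley_coords algebra_simps)

lemma cayley_add_mult:
  fixes x y z :: cayley
  shows "(x + y) * z = x * z + y * z" "z * (x + y) = z * x + z * y"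
    "(x - y) * z = x * z - y * z" "z * (x - y) = z * x - z * y"
  by (simp_all add: cayley_coords algebra_simps)

lemma cayley_cjg_linear:
  fixes x y :: cayley
  shows "cjg (x + y) = cjg x + cjg y" "cjg (x - y) = cjg x - cjg y"
    "cjg (r *\<^sub>R x) = r *\<^sub>R cjg x"
  by (simp_all add: cayley_coords)

lemma cayley_scalar_part_linear:
  fixes x y :: cayley
  shows "scalar_part (x + y) = scalar_part x + scalar_part y"
    "scalar_part (x - y) = scalar_part x - scalar_part y"
    "scalar_part (r *\<^sub>R x) = r * scalar_part x"
  by (simp_all add: cayley_coords)

lemma complex_cayley_inner_eq:
  fixes a b :: complex_cayley
  shows "ccay_inner a b =
    Complex (cay_inner (CRe a) (CRe b) - cay_inner (CIm a) (CIm b))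
      (cay_inner (CRe a) (CIm b) + cay_inner (CIm a) (CRe b))"
  by (simp add: ccay_inner_def cay_inner_def cscalar_part_def cayley_scalar_part_linear algebra_simps)

lemma complex_cayley_inner_scaleC_one:
  fixes a b :: complex_cayley
  shows "ccay_inner a b *\<^sub>c 1 = (1/2) *\<^sub>c (a * cjg b + b * cjg a)"
  by (simp add: complex_cayley_inner_eq complexified_eq_iff scaleR_left_diff_distrib
      scaleR_left_distrib cayley_inner_scaleR_one scaleR_right_distrib scaleR_right_diff_distrib)

lemma cayley_norm_scaleR_one:
  fixes a :: cayley
  shows "cay_norm a *\<^sub>R 1 = a * cjg a" "cay_norm a *\<^sub>R 1 = cjg a * a"
  by (simp_all add: cay_norm_def cay_inner_def cayley_coords algebra_simps)

lemma split_cayley_norm_scaleR_one: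
  fixes a :: split_cayley
  shows "cay_norm a *\<^sub>R 1 = a * cjg a" "cay_norm a *\<^sub>R 1 = cjg a * a"
  by (simp_all add: cay_norm_def cay_inner_def split_cayley_coords algebra_simps)

lemma cayley_inner_scaleR_one':
  fixes a b :: cayley
  shows "cay_inner a b *\<^sub>R 1 = (1/2) *\<^sub>R (cjg a * b + cjg b * a)"
  by (simp add: cay_inner_def cayley_coords algebra_simps)

lemma complex_cayley_norm_scaleC_one:
  fixes a :: complex_cayley
  shows "ccay_norm a *\<^sub>c 1 = a * cjg a" "ccay_norm a *\<^sub>c 1 = cjg a * a"
proof -
  have "ccay_norm a *\<^sub>c 1 = (1/2) *\<^sub>c (a * cjg a + a * cjg a)"
    by (simp add: ccay_norm_def complex_cayley_inner_scaleC_one)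
  then show "ccay_norm a *\<^sub>c 1 = a * cjg a"
    by (simp add: complexified_eq_iff flip: scaleR_2)
  show "ccay_norm a *\<^sub>c 1 = cjg a * a"
    by (simp add: ccay_norm_def complex_cayley_inner_eq complexified_eq_iff
        scaleR_left_diff_distrib scaleR_left_distrib cayley_inner_scaleR_one'
        scaleR_right_distrib scaleR_right_diff_distrib flip: scaleR_2)
       (simp add: algebra_simps flip: scaleR_add_left)
qed

lemma cayley_scaleR_mult:
  fixes x y :: cayley
  shows "(r *\<^sub>R x) * y = r *\<^sub>R (x * y)" "x * (r *\<^sub>R y) = r *\<^sub>R (x * y)"
  by (simp_all add: cayley_coords algebra_simps)

lemma split_cayley_scaleR_mult:
  fixes x y :: split_cayley
  shows "(r *\<^sub>R x) * y = r *\<^sub>R (x * y)" "x * (r *\<^sub>R y) = r *\<^sub>R (x * y)"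
  by (simp_all add: split_cayley_coords algebra_simps)

lemma complex_cayley_scaleC_mult:
  fixes x y :: complex_cayley
  shows "(c *\<^sub>c x) * y = c *\<^sub>c (x * y)" "x * (c *\<^sub>c y) = c *\<^sub>c (x * y)"
  by (simp_all add: complexified_eq_iff cayley_add_mult cayley_scaleR_mult algebra_simps)

lemma scaleC_scaleC: "c *\<^sub>c (d *\<^sub>c x) = (c * d) *\<^sub>c x"
  by (simp add: complexified_eq_iff algebra_simps)

lemma scaleC_one: "1 *\<^sub>c x = x"
  by (simp add: complexified_eq_iff)

lemma cayley_inv:
  fixes a :: cayley
  assumes "cay_norm a \<noteq> 0"
  shows "a * cay_inv a = 1" "cay_inv a * a = 1"
  using assms
  by (simp_all add: cay_inv_def cayley_scaleR_mult flip: cayley_norm_scaleR_one)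

lemma split_cayley_inv:
  fixes a :: split_cayley
  assumes "cay_norm a \<noteq> 0"
  shows "a * cay_inv a = 1" "cay_inv a * a = 1"
  using assms
  by (simp_all add: cay_inv_def split_cayley_scaleR_mult flip: split_cayley_norm_scaleR_one)

lemma complex_cayley_inv:
  fixes a :: complex_cayley
  assumes "ccay_norm a \<noteq> 0"
  shows "a * ccay_inv a = 1" "ccay_inv a * a = 1"
  using assms
  by (simp_all add: ccay_inv_def complex_cayley_scaleC_mult scaleC_scaleC scaleC_one
      flip: complex_cayley_norm_scaleC_one)

text \<open>The bracketing in \<open>p a p\<^sup>-\<^sup>1\<close> is immaterial.\<close>

lemma cayley_conj_assoc:
  fixes p a :: cayley
  shows "(p * a) * cay_inv p = p * (a * cay_inv p)"
proof -
  have "(p * a) * cjg p = p * (a * cjg p)"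
    by (simp add: cayley_coords algebra_simps)
  then show ?thesis
    by (simp add: cay_inv_def cayley_scaleR_mult)
qed

lemma split_cayley_conj_assoc:
  fixes p a :: split_cayley
  shows "(p * a) * cay_inv p = p * (a * cay_inv p)"
proof -
  have "(p * a) * cjg p = p * (a * cjg p)"
    by (simp add: split_cayley_coords algebra_simps)
  then show ?thesis
    by (simp add: cay_inv_def split_cayley_scaleR_mult)
qed

lemma complex_cayley_conj_assoc:
  fixes p a :: complex_cayley
  shows "(p * a) * ccay_inv p = p * (a * ccay_inv p)"
proof -
  have eq: "(x * z) * cjg x = x * (z * cjg x)" for x z :: cayley
    by (simp add: cayley_coords algebra_simps)
  have polar: "(x * z) * cjg y + (y * z) * cjg x = x * (z * cjg y) + y * (z * cjg x)"
    for x y z :: cayley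
    using eq[of "x + y" z] eq[of x z] eq[of y z]
    by (simp add: cayley_add_mult cayley_cjg_linear algebra_simps)
  have "(p * a) * cjg p = p * (a * cjg p)"
    using eq[of "CRe p" "CRe a"] eq[of "CRe p" "CIm a"] eq[of "CIm p" "CRe a"]
      eq[of "CIm p" "CIm a"] polar[of "CRe p" "CRe a" "CIm p"] polar[of "CRe p" "CIm a" "CIm p"]
    by (simp add: complexified_eq_iff cayley_add_mult algebra_simps)
  then show ?thesis
    by (simp add: ccay_inv_def complex_cayley_scaleC_mult)
qed

end

theory Submission imports Defs begin

text \<open>
  For imaginary \<open>p\<close> and \<open>a\<close> with \<open>N(p) \<noteq> 0\<close> one has
  \<open>p a p\<^sup>-\<^sup>1 = (2 (p, a) / N(p)) p - a\<close>, which is the half-turn about \<open>p\<close>: it fixes \<open>p\<close> and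
  negates the orthogonal complement of \<open>p\<close>. The assertion is therefore one about half-turns of the
  quadratic space of imaginary elements, and the multiplication enters only through this formula
  (\<open>cayley_conj_eq_half_turn\<close> and its split and complex versions).

  If \<open>N(a) = N(b)\<close> and \<open>N(a + b) \<noteq> 0\<close>, the half-turn about the bisector \<open>a + b\<close> takes \<open>a\<close> to \<open>b\<close>
  (\<open>half_turn_sum\<close>). In the division algebra the norm is positive definite, so this covers every case
  except \<open>b = - a\<close>, where any nonzero axis orthogonal to \<open>a\<close> does the job.

  In the other two algebras \<open>a + b\<close> can be a nonzero vector of norm zero. A preliminary half-turn
  about \<open>p\<close> moves \<open>a\<close> to some \<open>c\<close>, and the bisector of \<open>c\<close> and \<open>b\<close> serves as the second axis as soon
  as \<open>N(c + b) \<noteq> 0\<close>. Multiplied by \<open>N(p) / 2\<close>, this number becomes the quadratic form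
  \<open>N(p) (N(a) - (a, b)) + 2 (p, a) (p, b)\<close> in \<open>p\<close>, and \<open>ex_first_axis\<close> finds a \<open>p\<close> at which neither
  it nor \<open>N\<close> vanishes.
\<close>

section \<open>Half-turns in quadratic spaces\<close>

text \<open>
  The form \<open>B\<close> is bilinear everywhere, but is required to be nondegenerate only on the subspace
  \<open>V\<close>, so that \<open>V\<close> can be the imaginary part of an algebra. The orthogonal triple says that the
  dimension of \<open>V\<close> is at least three. In a hyperbolic plane \<open>ex_anisotropic_orthogonal\<close> would fail,
  because there a nonzero vector of norm zero spans its own orthogonal complement.
\<close>

locale quadratic_space = vector_space scale
  for scale :: "'f::field_char_0 \<Rightarrow> 'v::ab_group_add \<Rightarrow> 'v" (infixr "*s" 75) +
  fixes V :: "'v set" and B :: "'v \<Rightarrow> 'v \<Rightarrow> 'f"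
  assumes subspace_V: "subspace V"
    and B_commute: "B x y = B y x"
    and B_add_left: "B (x + y) z = B x z + B y z"
    and B_scale_left: "B (c *s x) y = c * B x y"
    and nondegenerate: "\<lbrakk>a \<in> V; a \<noteq> 0\<rbrakk> \<Longrightarrow> \<exists>x\<in>V. B x a \<noteq> 0"
    and orthogonal_triple: "\<exists>u\<in>V. \<exists>v\<in>V. \<exists>w\<in>V. B u u \<noteq> 0 \<and> B v v \<noteq> 0 \<and> B w w \<noteq> 0 \<and>
      B u v = 0 \<and> B u w = 0 \<and> B v w = 0"
begin

lemma B_add_right: "B z (x + y) = B z x + B z y"
  by (metis B_commute B_add_left)

lemma B_scale_right: "B y (c *s x) = c * B y x"
  by (metis B_commute B_scale_left)

lemma B_diff_left: "B (x - y) z = B x z - B y z"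
  by (metis B_add_left add_diff_cancel_right' diff_add_cancel)

lemma B_diff_right: "B z (x - y) = B z x - B z y"
  by (metis B_commute B_diff_left)

lemmas B_bilinear = B_add_left B_add_right B_diff_left B_diff_right B_scale_left B_scale_right

definition half_turn :: "'v \<Rightarrow> 'v \<Rightarrow> 'v" where
  "half_turn p x = (2 * B p x / B p p) *s p - x"

lemma half_turn_in_V: "\<lbrakk>p \<in> V; x \<in> V\<rbrakk> \<Longrightarrow> half_turn p x \<in> V"
  unfolding half_turn_def using subspace_V by (intro subspace_diff subspace_scale)

lemma half_turn_isometry:
  assumes "B p p \<noteq> 0"
  shows "B (half_turn p x) (half_turn p x) = B x x"
  using assms by (simp add: half_turn_def B_bilinear B_commute[of x p] field_simps)

text \<open>
  As \<open>a\<close> and \<open>b\<close> have the same norm, \<open>a\<close> is the sum of \<open>(a + b) / 2\<close> on the axis and \<open>(a - b) / 2\<close>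
  orthogonal to it; negating the second part gives \<open>b\<close>.
\<close>

lemma half_turn_sum:
  assumes "B a a = B b b" and "B (a + b) (a + b) \<noteq> 0"
  shows "half_turn (a + b) a = b"
proof -
  have "B (a + b) (a + b) = 2 * B (a + b) a"
    using assms(1) by (simp add: B_bilinear B_commute[of b a])
  then have "2 * B (a + b) a / B (a + b) (a + b) = 1"
    using assms(2) by simp
  then show ?thesis by (simp add: half_turn_def)
qed

lemma half_turn_orthogonal: "B p x = 0 \<Longrightarrow> half_turn p x = - x"
  by (simp add: half_turn_def)

text \<open>
  Two orthogonal vectors \<open>x\<close>, \<open>y\<close> combine to \<open>(y, a) x - (x, a) y\<close>, which is orthogonal to \<open>a\<close> and
  has norm \<open>(y, a)\<^sup>2 N(x) + (x, a)\<^sup>2 N(y)\<close>. If this norm vanishes for all pairs from an orthogonal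
  triple \<open>u\<close>, \<open>v\<close>, \<open>w\<close>, then each two of \<open>(u, a)\<^sup>2 / N(u)\<close>, \<open>(v, a)\<^sup>2 / N(v)\<close>,
  \<open>(w, a)\<^sup>2 / N(w)\<close> are negatives of each other. Hence all three are zero, and \<open>u\<close> itself is
  orthogonal to \<open>a\<close>.
\<close>

lemma ex_anisotropic_orthogonal: "\<exists>p\<in>V. B p p \<noteq> 0 \<and> B p a = 0"
proof (rule ccontr)
  assume "\<not> ?thesis"
  then have isotropic: "B p p = 0" if "p \<in> V" "B p a = 0" for p
    using that by blast
  have combination: "(B y a)\<^sup>2 * B x x = - ((B x a)\<^sup>2 * B y y)"
    if "x \<in> V" "y \<in> V" "B x y = 0" for x y
  proof -
    have "B (B y a *s x - B x a *s y) (B y a *s x - B x a *s y) = 0"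
    proof (rule isotropic)
      show "B y a *s x - B x a *s y \<in> V"
        using that subspace_V by (intro subspace_diff subspace_scale)
      show "B (B y a *s x - B x a *s y) a = 0"
        by (simp add: B_bilinear)
    qed
    then show ?thesis
      using that by (simp add: B_bilinear B_commute[of y x] power2_eq_square algebra_simps
          eq_neg_iff_add_eq_0)
  qed
  obtain u v w where uvw: "u \<in> V" "v \<in> V" "w \<in> V"
    and ne: "B u u \<noteq> 0" "B v v \<noteq> 0" "B w w \<noteq> 0"
    and orth: "B u v = 0" "B u w = 0" "B v w = 0"
    using orthogonal_triple by blast
  note eqs = combination[OF uvw(1,2) orth(1)] combination[OF uvw(1,3) orth(2)]
    combination[OF uvw(2,3) orth(3)]
  have "2 * ((B u a)\<^sup>2 * B v v * B w w) = 0"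
    using eqs by algebra
  then have "B u a = 0"
    using ne by simp
  then show False
    using isotropic uvw(1) ne(1) by blast
qed

text \<open>
  A vector space is not the union of two proper subspaces, here the orthogonal complements of \<open>a\<close>
  and \<open>b\<close>.
\<close>

lemma ex_not_orthogonal_both:
  assumes "a \<in> V" "a \<noteq> 0" "b \<in> V" "b \<noteq> 0"
  shows "\<exists>x\<in>V. B x a \<noteq> 0 \<and> B x b \<noteq> 0"
proof -
  obtain x y where xy: "x \<in> V" "B x a \<noteq> 0" "y \<in> V" "B y b \<noteq> 0"
    using nondegenerate assms by meson
  then have "x + y \<in> V" using subspace_V by (intro subspace_add)
  show ?thesis
  proof (cases "B x b = 0 \<and> B y a = 0")
    case True
    then have "B (x + y) a \<noteq> 0 \<and> B (x + y) b \<noteq> 0"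
      using xy by (simp add: B_bilinear)
    then show ?thesis using \<open>x + y \<in> V\<close> by blast
  next
    case False
    then show ?thesis using xy by blast
  qed
qed

text \<open>
  For \<open>N(p) \<noteq> 0\<close> the second number is \<open>N(p) / 2\<close> times the norm of the sum of \<open>b\<close> and the
  image of \<open>a\<close> under the half-turn about \<open>p\<close>. If \<open>N(a) \<noteq> (a, b)\<close>, an axis orthogonal to \<open>a\<close> kills its
  second summand and leaves the first. If \<open>N(a) = (a, b)\<close>, only \<open>2 (p, a) (p, b)\<close> remains: \<open>p = a\<close>
  works when \<open>N(a) \<noteq> 0\<close>; otherwise \<open>a\<close> and \<open>b\<close> are orthogonal vectors of norm zero, and any \<open>x\<close>
  orthogonal to neither of them works, after replacement by \<open>x + a\<close> if \<open>N(x) = 0\<close>: this keeps both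
  inner products and makes the norm \<open>2 (x, a)\<close>.
\<close>

lemma ex_first_axis:
  assumes "a \<in> V" "a \<noteq> 0" "b \<in> V" "b \<noteq> 0" and eq: "B a a = B b b"
  shows "\<exists>p\<in>V. B p p \<noteq> 0 \<and> B p p * (B a a - B a b) + 2 * B p a * B p b \<noteq> 0"
proof -
  consider "B a a \<noteq> B a b" | "B a a = B a b" "B a a \<noteq> 0" | "B a a = 0" "B a b = 0"
    by fastforce
  then show ?thesis
  proof cases
    case 1
    obtain p where "p \<in> V" "B p p \<noteq> 0" "B p a = 0"
      using ex_anisotropic_orthogonal by blast
    then show ?thesis using 1 by (intro bexI[of _ p]) auto
  next
    case 2
    then show ?thesis using \<open>a \<in> V\<close> by (intro bexI[of _ a]) auto
  next
    case 3
    obtain x where x: "x \<in> V" "B x a \<noteq> 0" "B x b \<noteq> 0"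
      using ex_not_orthogonal_both assms by blast
    show ?thesis
    proof (cases "B x x = 0")
      case True
      have "B (x + a) (x + a) = 2 * B x a" "B (x + a) a = B x a" "B (x + a) b = B x b"
        using True 3 by (simp_all add: B_bilinear B_commute[of a x])
      moreover have "x + a \<in> V"
        using x(1) \<open>a \<in> V\<close> subspace_V by (intro subspace_add)
      ultimately show ?thesis
        using x 3 by (intro bexI[of _ "x + a"]) auto
    next
      case False
      then show ?thesis using x 3 by (intro bexI[of _ x]) auto
    qed
  qed
qed

theorem two_half_turns_transitive:
  assumes "a \<in> V" "a \<noteq> 0" "b \<in> V" "b \<noteq> 0" and eq: "B a a = B b b"
  shows "\<exists>p\<in>V. \<exists>q\<in>V. B p p \<noteq> 0 \<and> B q q \<noteq> 0 \<and> half_turn q (half_turn p a) = b"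
proof -
  obtain p where p: "p \<in> V" "B p p \<noteq> 0"
    and F: "B p p * (B a a - B a b) + 2 * B p a * B p b \<noteq> 0"
    using ex_first_axis assms by blast
  define c where "c = half_turn p a"
  have c: "c \<in> V" "B c c = B b b"
    using p \<open>a \<in> V\<close> eq by (simp_all add: c_def half_turn_in_V half_turn_isometry)
  have "B p p * B c b = 2 * B p a * B p b - B p p * B a b"
    using p(2) by (simp add: c_def half_turn_def B_bilinear field_simps)
  moreover have "B (c + b) (c + b) = 2 * (B a a + B c b)"
    using c(2) eq by (simp add: B_bilinear B_commute[of b c])
  ultimately have "B p p * B (c + b) (c + b) =
      2 * (B p p * (B a a - B a b) + 2 * B p a * B p b)"
    by algebra
  then have "B (c + b) (c + b) \<noteq> 0"
    using F by (metis mult_eq_0_iff zero_neq_numeral)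
  moreover from this have "half_turn (c + b) c = b"
    using c(2) by (intro half_turn_sum)
  moreover have "c + b \<in> V"
    using c(1) \<open>b \<in> V\<close> subspace_V by (intro subspace_add)
  ultimately show ?thesis
    using p unfolding c_def by blast
qed

theorem half_turn_transitive_anisotropic:
  assumes anisotropic: "\<And>x. x \<in> V \<Longrightarrow> x \<noteq> 0 \<Longrightarrow> B x x \<noteq> 0"
    and "a \<in> V" "b \<in> V" "B a a = B b b"
  shows "\<exists>p\<in>V. B p p \<noteq> 0 \<and> half_turn p a = b"
proof (cases "a + b = 0")
  case True
  then have "b = - a" by (simp add: add_eq_0_iff)
  then show ?thesis
    using ex_anisotropic_orthogonal[of a] half_turn_orthogonal by blast
next
  case False
  moreover have "a + b \<in> V"
    using assms subspace_V by (intro subspace_add)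
  ultimately show ?thesis
    using half_turn_sum assms by blast
qed

end

section \<open>The imaginary parts as quadratic spaces\<close>

lemma cay_inner_cayley:
  fixes x y :: cayley
  shows "cay_inner x y =
    Q0 (Dfst x) * Q0 (Dfst y) + Q1 (Dfst x) * Q1 (Dfst y) +
    Q2 (Dfst x) * Q2 (Dfst y) + Q3 (Dfst x) * Q3 (Dfst y) +
    Q0 (Dsnd x) * Q0 (Dsnd y) + Q1 (Dsnd x) * Q1 (Dsnd y) +
    Q2 (Dsnd x) * Q2 (Dsnd y) + Q3 (Dsnd x) * Q3 (Dsnd y)"
  by (simp add: cay_inner_def cayley_coords algebra_simps)

lemma cay_inner_split_cayley:
  fixes x y :: split_cayley
  shows "cay_inner x y =
    S0 (Dfst x) * S0 (Dfst y) - S1 (Dfst x) * S1 (Dfst y) +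
    S2 (Dfst x) * S2 (Dfst y) - S3 (Dfst x) * S3 (Dfst y) +
    S0 (Dsnd x) * S0 (Dsnd y) - S1 (Dsnd x) * S1 (Dsnd y) +
    S2 (Dsnd x) * S2 (Dsnd y) - S3 (Dsnd x) * S3 (Dsnd y)"
  by (simp add: cay_inner_def split_cayley_coords algebra_simps)

lemma cayley_pure_iff: "(x :: cayley) \<in> pure \<longleftrightarrow> Q0 (Dfst x) = 0"
  by (auto simp: pure_def cayley_coords)

lemma split_cayley_pure_iff: "(x :: split_cayley) \<in> pure \<longleftrightarrow> S0 (Dfst x) = 0"
  by (auto simp: pure_def split_cayley_coords)

lemma complex_cayley_pure_iff:
  "(x :: complex_cayley) \<in> pure \<longleftrightarrow> CRe x \<in> pure \<and> CIm x \<in> pure"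
  by (auto simp: pure_def complexified_eq_iff)

text \<open>Anisotropy is what lets a single half-turn suffice in the division algebra.\<close>

lemma cay_inner_pos:
  fixes x :: cayley
  assumes "x \<noteq> 0"
  shows "cay_inner x x > 0"
proof -
  have "cay_inner x x \<ge> 0"
    by (simp add: cay_inner_cayley)
  moreover have "cay_inner x x \<noteq> 0"
    using assms by (auto simp: cay_inner_cayley cayley_coords add_nonneg_eq_0_iff)
  ultimately show ?thesis by simp
qed

lemma cayley_pure_quadratic_space:
  "quadratic_space scaleR (pure :: cayley set) cay_inner"
proof unfold_locales
  show "module.subspace scaleR (pure :: cayley set)"
    by (fold subspace_raw_def, rule real_vector.subspaceI) (auto simp: cayley_pure_iff)
next
  fix a :: cayley
  assume "a \<in> pure" "a \<noteq> 0"
  then show "\<exists>x\<in>pure. cay_inner x a \<noteq> 0"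
    using cay_inner_pos by force
next
  show "\<exists>u\<in>pure. \<exists>v\<in>pure. \<exists>w\<in>pure :: cayley set.
      cay_inner u u \<noteq> 0 \<and> cay_inner v v \<noteq> 0 \<and> cay_inner w w \<noteq> 0 \<and>
      cay_inner u v = 0 \<and> cay_inner u w = 0 \<and> cay_inner v w = 0"
    by (rule bexI[of _ "Double (Quat 0 1 0 0) 0"], rule bexI[of _ "Double (Quat 0 0 1 0) 0"],
        rule bexI[of _ "Double (Quat 0 0 0 1) 0"])
      (simp_all add: cay_inner_cayley cayley_pure_iff)
qed (simp_all add: cay_inner_cayley algebra_simps)

lemma split_cayley_pure_quadratic_space:
  "quadratic_space scaleR (pure :: split_cayley set) cay_inner"
proof unfold_locales
  show "module.subspace scaleR (pure :: split_cayley set)"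
    by (fold subspace_raw_def, rule real_vector.subspaceI) (auto simp: split_cayley_pure_iff)
next
  fix a :: split_cayley
  assume a: "a \<in> pure" "a \<noteq> 0"
  \<comment> \<open>Negating the coordinates that enter the form with a minus sign turns \<open>(x, a)\<close> into the sum of
    the squares of the coordinates of \<open>a\<close>.\<close>
  define x where
    "x = Double (Squat 0 (- S1 (Dfst a)) (S2 (Dfst a)) (- S3 (Dfst a)))
      (Squat (S0 (Dsnd a)) (- S1 (Dsnd a)) (S2 (Dsnd a)) (- S3 (Dsnd a)))"
  have "x \<in> pure"
    by (simp add: x_def split_cayley_pure_iff)
  moreover have "cay_inner x a \<noteq> 0"
    using a by (auto simp: x_def cay_inner_split_cayley split_cayley_pure_iff
        split_cayley_coords add_nonneg_eq_0_iff)
  ultimately show "\<exists>x\<in>pure. cay_inner x a \<noteq> 0" by blast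
next
  \<comment> \<open>The axes \<open>e\<^sub>1'\<close>, \<open>e\<^sub>2\<close>, \<open>e\<^sub>3'\<close> have norms \<open>-1\<close>, \<open>1\<close>, \<open>-1\<close>.\<close>
  show "\<exists>u\<in>pure. \<exists>v\<in>pure. \<exists>w\<in>pure :: split_cayley set.
      cay_inner u u \<noteq> 0 \<and> cay_inner v v \<noteq> 0 \<and> cay_inner w w \<noteq> 0 \<and>
      cay_inner u v = 0 \<and> cay_inner u w = 0 \<and> cay_inner v w = 0"
    by (rule bexI[of _ "Double (Squat 0 1 0 0) 0"], rule bexI[of _ "Double (Squat 0 0 1 0) 0"],
        rule bexI[of _ "Double (Squat 0 0 0 1) 0"])
      (simp_all add: cay_inner_split_cayley split_cayley_pure_iff)
qed (simp_all add: cay_inner_split_cayley algebra_simps)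

lemma vector_space_scaleC:
  "vector_space (scaleC :: complex \<Rightarrow> 'a::conj_algebra complexified \<Rightarrow> _)"
  by unfold_locales (simp_all add: complexified_eq_iff algebra_simps)

lemma complex_cayley_pure_quadratic_space:
  "quadratic_space scaleC (pure :: complex_cayley set) ccay_inner"
proof -
  interpret vector_space "scaleC :: complex \<Rightarrow> complex_cayley \<Rightarrow> _"
    by (rule vector_space_scaleC)
  interpret R: quadratic_space scaleR "pure :: cayley set" cay_inner
    by (rule cayley_pure_quadratic_space)
  show ?thesis
  proof unfold_locales
    show "subspace (pure :: complex_cayley set)"
      by (rule subspaceI) (auto simp: complex_cayley_pure_iff cayley_pure_iff)
  next
    fix x y z :: complex_cayley
    show "ccay_inner x y = ccay_inner y x"
      by (simp add: complex_cayley_inner_eq R.B_commute)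
    show "ccay_inner (x + y) z = ccay_inner x z + ccay_inner y z"
      by (simp add: complex_cayley_inner_eq R.B_bilinear complex_eq_iff)
  next
    fix c :: complex and x y :: complex_cayley
    show "ccay_inner (c *\<^sub>c x) y = c * ccay_inner x y"
      by (simp add: complex_cayley_inner_eq R.B_bilinear complex_eq_iff algebra_simps)
  next
    fix a :: complex_cayley
    assume a: "a \<in> pure" "a \<noteq> 0"
    \<comment> \<open>Pairing \<open>a\<close> with its complex conjugate gives the Hermitian square of \<open>a\<close>, which is positive.\<close>
    define x where "x = Cplx (CRe a) (- CIm a)"
    have "x \<in> pure"
      using a by (simp add: x_def complex_cayley_pure_iff cayley_pure_iff)
    moreover have "Re (ccay_inner x a) = cay_inner (CRe a) (CRe a) + cay_inner (CIm a) (CIm a)"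
      by (simp add: x_def complex_cayley_inner_eq cay_inner_cayley)
    moreover have "cay_inner (CRe a) (CRe a) + cay_inner (CIm a) (CIm a) > 0"
    proof (cases "CRe a = 0")
      case True
      then have "CIm a \<noteq> 0" using a by (simp add: complexified_eq_iff)
      then show ?thesis using True cay_inner_pos by (simp add: cay_inner_cayley[of 0])
    next
      case False
      then show ?thesis
        using cay_inner_pos[of "CRe a"] cay_inner_pos[of "CIm a"]
        by (cases "CIm a = 0") (auto simp: cay_inner_cayley[of 0])
    qed
    ultimately show "\<exists>x\<in>pure. ccay_inner x a \<noteq> 0"
      by (metis less_irrefl zero_complex.sel(1))
  next
    obtain u v w :: cayley where
      "u \<in> pure" "v \<in> pure" "w \<in> pure"
      "cay_inner u u \<noteq> 0" "cay_inner v v \<noteq> 0" "cay_inner w w \<noteq> 0"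
      "cay_inner u v = 0" "cay_inner u w = 0" "cay_inner v w = 0"
      using R.orthogonal_triple by blast
    then show "\<exists>u\<in>pure. \<exists>v\<in>pure. \<exists>w\<in>pure :: complex_cayley set.
        ccay_inner u u \<noteq> 0 \<and> ccay_inner v v \<noteq> 0 \<and> ccay_inner w w \<noteq> 0 \<and>
        ccay_inner u v = 0 \<and> ccay_inner u w = 0 \<and> ccay_inner v w = 0"
      by (intro bexI[of _ "Cplx u 0"] bexI[of _ "Cplx v 0"] bexI[of _ "Cplx w 0"])
        (simp_all add: complex_cayley_inner_eq complex_cayley_pure_iff cayley_pure_iff
          cay_inner_cayley complex_eq_iff)
  qed
qed

section \<open>Conjugation by an imaginary element\<close>

text \<open>
  For imaginary elements \<open>p a = - a p - 2 (p, a)\<close> and \<open>p p = - N(p)\<close>, so that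
  \<open>p a p = N(p) a - 2 (p, a) p\<close>. Since \<open>cjg p = - p\<close>, the sign is the opposite one here.
\<close>

lemma cayley_conj_pure:
  fixes p a :: cayley
  assumes "p \<in> pure" "a \<in> pure"
  shows "(p * a) * cjg p = (2 * cay_inner p a) *\<^sub>R p - cay_inner p p *\<^sub>R a"
  using assms by (simp add: cayley_pure_iff cay_inner_cayley cayley_coords algebra_simps)

lemma split_cayley_conj_pure:
  fixes p a :: split_cayley
  assumes "p \<in> pure" "a \<in> pure"
  shows "(p * a) * cjg p = (2 * cay_inner p a) *\<^sub>R p - cay_inner p p *\<^sub>R a"
  using assms
  by (simp add: split_cayley_pure_iff cay_inner_split_cayley split_cayley_coords algebra_simps)

text \<open>
  The identity \<open>cayley_conj_pure\<close> is quadratic in \<open>p\<close>. Its value at \<open>x + i y\<close> involves the mixed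
  terms in \<open>x\<close> and \<open>y\<close>, which the polarized form provides.
\<close>

lemma cayley_conj_pure_polarized:
  fixes p q a :: cayley
  assumes "p \<in> pure" "q \<in> pure" "a \<in> pure"
  shows "(p * a) * cjg q + (q * a) * cjg p =
    (2 * cay_inner p a) *\<^sub>R q + (2 * cay_inner q a) *\<^sub>R p - (2 * cay_inner p q) *\<^sub>R a"
  using assms by (simp add: cayley_pure_iff cay_inner_cayley cayley_coords algebra_simps)

lemma complex_cayley_conj_pure:
  fixes p a :: complex_cayley
  assumes "p \<in> pure" "a \<in> pure"
  shows "(p * a) * cjg p = (2 * ccay_inner p a) *\<^sub>c p - ccay_inner p p *\<^sub>c a"
proof -
  have pure: "CRe p \<in> pure" "CIm p \<in> pure" "CRe a \<in> pure" "CIm a \<in> pure"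
    using assms by (simp_all add: complex_cayley_pure_iff)
  have sym: "cay_inner (CIm p) (CRe p) = cay_inner (CRe p) (CIm p)"
    by (simp add: cay_inner_cayley)
  have polar: "(CRe p * z) * cjg (CIm p) = (2 * cay_inner (CRe p) z) *\<^sub>R CIm p +
      (2 * cay_inner (CIm p) z) *\<^sub>R CRe p - (2 * cay_inner (CRe p) (CIm p)) *\<^sub>R z
      - (CIm p * z) * cjg (CRe p)" if "z \<in> pure" for z
    using cayley_conj_pure_polarized[OF pure(1,2) that] by (simp add: eq_diff_eq)
  show ?thesis
    by (simp add: complexified_eq_iff cayley_add_mult cayley_conj_pure pure polar
        complex_cayley_inner_eq sym scaleR_left_distrib scaleR_left_diff_distrib algebra_simps)
qed

lemma cayley_conj_eq_half_turn:
  fixes p a :: cayley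
  assumes "p \<in> pure" "a \<in> pure" "cay_inner p p \<noteq> 0"
  shows "(p * a) * cay_inv p = quadratic_space.half_turn scaleR cay_inner p a"
  using assms
  by (simp add: quadratic_space.half_turn_def[OF cayley_pure_quadratic_space] cay_inv_def
      cay_norm_def cayley_scaleR_mult cayley_conj_pure scaleR_diff_right)

lemma split_cayley_conj_eq_half_turn:
  fixes p a :: split_cayley
  assumes "p \<in> pure" "a \<in> pure" "cay_inner p p \<noteq> 0"
  shows "(p * a) * cay_inv p = quadratic_space.half_turn scaleR cay_inner p a"
  using assms
  by (simp add: quadratic_space.half_turn_def[OF split_cayley_pure_quadratic_space] cay_inv_def
      cay_norm_def split_cayley_scaleR_mult split_cayley_conj_pure scaleR_diff_right)

lemma complex_cayley_conj_eq_half_turn: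
  fixes p a :: complex_cayley
  assumes "p \<in> pure" "a \<in> pure" "ccay_inner p p \<noteq> 0"
  shows "(p * a) * ccay_inv p = quadratic_space.half_turn scaleC ccay_inner p a"
proof -
  interpret vector_space "scaleC :: complex \<Rightarrow> complex_cayley \<Rightarrow> _"
    by (rule vector_space_scaleC)
  show ?thesis
    using assms
    by (simp add: quadratic_space.half_turn_def[OF complex_cayley_pure_quadratic_space]
        ccay_inv_def ccay_norm_def complex_cayley_scaleC_mult complex_cayley_conj_pure
        scale_right_diff_distrib)
qed

section \<open>Transitivity on imaginary elements of equal norm\<close>

theorem cayley_transitive:
  fixes a b :: cayley
  assumes "a \<in> pure_nonzero" "b \<in> pure_nonzero" "cay_norm a = cay_norm b"
  shows "\<exists>p\<in>pure_nonzero. (p * a) * cay_inv p = b"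
proof -
  interpret quadratic_space scaleR "pure :: cayley set" cay_inner
    by (rule cayley_pure_quadratic_space)
  have a: "a \<in> pure" "b \<in> pure" "cay_inner a a = cay_inner b b"
    using assms by (simp_all add: pure_nonzero_def cay_norm_def)
  obtain p where "p \<in> pure" "cay_inner p p \<noteq> 0" "half_turn p a = b"
    using half_turn_transitive_anisotropic[OF _ a] cay_inner_pos by fastforce
  moreover from this have "p \<noteq> 0"
    by (auto simp: cay_inner_cayley)
  ultimately show ?thesis
    using a by (intro bexI[of _ p]) (simp_all add: pure_nonzero_def cayley_conj_eq_half_turn)
qed

theorem split_cayley_transitive:
  fixes a b :: split_cayley
  assumes "a \<in> pure_nonzero" "b \<in> pure_nonzero" "cay_norm a = cay_norm b"
  shows "\<exists>p\<in>pure_units. \<exists>q\<in>pure_units. (q * ((p * a) * cay_inv p)) * cay_inv q = b"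
proof -
  interpret quadratic_space scaleR "pure :: split_cayley set" cay_inner
    by (rule split_cayley_pure_quadratic_space)
  have a: "a \<in> pure" "a \<noteq> 0" "b \<in> pure" "b \<noteq> 0" "cay_inner a a = cay_inner b b"
    using assms by (simp_all add: pure_nonzero_def cay_norm_def)
  obtain p q where "p \<in> pure" "q \<in> pure" "cay_inner p p \<noteq> 0" "cay_inner q q \<noteq> 0"
    "half_turn q (half_turn p a) = b"
    using two_half_turns_transitive[OF a] by blast
  then show ?thesis
    using a
    by (intro bexI[of _ p] bexI[of _ q])
      (simp_all add: pure_units_def cay_norm_def split_cayley_conj_eq_half_turn half_turn_in_V)
qed

theorem complex_cayley_transitive:
  fixes a b :: complex_cayley
  assumes "a \<in> pure_nonzero" "b \<in> pure_nonzero" "ccay_norm a = ccay_norm b"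
  shows "\<exists>p\<in>cpure_units. \<exists>q\<in>cpure_units. (q * ((p * a) * ccay_inv p)) * ccay_inv q = b"
proof -
  interpret quadratic_space scaleC "pure :: complex_cayley set" ccay_inner
    by (rule complex_cayley_pure_quadratic_space)
  have a: "a \<in> pure" "a \<noteq> 0" "b \<in> pure" "b \<noteq> 0" "ccay_inner a a = ccay_inner b b"
    using assms by (simp_all add: pure_nonzero_def ccay_norm_def)
  obtain p q where "p \<in> pure" "q \<in> pure" "ccay_inner p p \<noteq> 0" "ccay_inner q q \<noteq> 0"
    "half_turn q (half_turn p a) = b"
    using two_half_turns_transitive[OF a] by blast
  then show ?thesis
    using a
    by (intro bexI[of _ p] bexI[of _ q])
      (simp_all add: cpure_units_def ccay_norm_def complex_cayley_conj_eq_half_turn half_turn_in_V)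
qed

theorem theorem3:
  shows
    "(\<forall>a \<in> (pure_nonzero :: cayley set). \<forall>b \<in> pure_nonzero. cay_norm a = cay_norm b \<longrightarrow>
        (\<exists>p \<in> pure_nonzero. (p * a) * cay_inv p = b)) \<and>
     (\<forall>a \<in> (pure_nonzero :: split_cayley set). \<forall>b \<in> pure_nonzero. cay_norm a = cay_norm b \<longrightarrow>
        (\<exists>p \<in> pure_units. \<exists>q \<in> pure_units. (q * ((p * a) * cay_inv p)) * cay_inv q = b)) \<and>
     (\<forall>a \<in> (pure_nonzero :: complex_cayley set). \<forall>b \<in> pure_nonzero. ccay_norm a = ccay_norm b \<longrightarrow>
        (\<exists>p \<in> cpure_units. \<exists>q \<in> cpure_units. (q * ((p * a) * ccay_inv p)) * ccay_inv q = b))"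
  using cayley_transitive split_cayley_transitive complex_cayley_transitive by blast

end
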